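(* Let $\Lambda$ be a finite-dimensional basic split $k$-algebra with Jacobson radical $J$ satisfying $J^n=0$. Let $e_i,e_j$ be primitive idempotents and suppose $V_{ij}=e_jJ^{n-1}e_i\neq 0$. Set $m_{ij}=\dim_kV_{ij}$. Then, for every $1\le s\le m_{ij}$, there is a natural bijection $$\mathcal F^{<n,\mathrm{top},s}_{ij}\;\cong\;\operatorname{Gr}_k(m_{ij}-s,V_{ij}).$$ Thus the rank-$s$ terminal ambiguity fibre is identified with the ordinary Grassmannian of codimension-$s$ $k$-subspaces of $V_{ij}$.
   Context: $k$ is a field; modules are finite-dimensional left $\Lambda$-modules, $n\ge 1$, $J^0=\Lambda$. Fix a complete set $e_1,\dots,e_t$ of primitive orthogonal idempotents of $\Lambda$, with $e_i,e_j$ among them; $\Lambda$ basic means the modules $\Lambda e_h$ are pairwise non-isomorphic, and split means $D_h=e_h\Lambda e_h/e_hJe_h\cong k$ for every $h$. Put $P_i=\Lambda e_i$ and $W_j=\bigoplus_{h\ne j}e_hJ^{n-1}P_i$. For a $k$-subspace $U\subseteq V_{ij}$ of codimension $s$ put $K_U=W_j\oplus U\subseteq J^{n-1}P_i$ (a $\Lambda$-submodule of $P_i$) and $M_U=P_i/K_U$. The rank-$s$ terminal ambiguity fibre is the set of isomorphism classes of $\Lambda$-modules $\mathcal F^{<n,\mathrm{top},s}_{ij}=\{M_U: U\in\operatorname{Gr}_k(m_{ij}-s,V_{ij})\}/\cong$, where $\operatorname{Gr}_k(r,V)$ is the set of $r$-dimensional $k$-subspaces of $V$. *)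

theory Defs
  imports
    "Jordan_Normal_Form.Missing_VectorSpace"
    "HOL-Algebra.Ideal_Product"
    "HOL-Algebra.QuotRing"
begin

text \<open>
  An associative unital algebra over a field is one record of type
  \<^typ>\<open>('k, 'a) module\<close>: its ring part is the multiplication of the algebra, its
  \<^const>\<open>smult\<close> is the scalar action of the field.  The locale \<^locale>\<open>algebra\<close> of HOL-Algebra
  cannot be used, since it asks for commutative multiplication.
\<close>

locale fd_algebra = vectorspace K A + ring A for K and A (structure) +
  assumes finite_dim: "vectorspace.fin_dim K A"
    and smult_mult_left:
      "\<lbrakk>c \<in> carrier K; x \<in> carrier A; y \<in> carrier A\<rbrakk> \<Longrightarrow> (c \<odot> x) \<otimes> y = c \<odot> (x \<otimes> y)"
    and smult_mult_right:
      "\<lbrakk>c \<in> carrier K; x \<in> carrier A; y \<in> carrier A\<rbrakk> \<Longrightarrow> x \<otimes> (c \<odot> y) = c \<odot> (x \<otimes> y)"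


section \<open>Left modules over a noncommutative ring\<close>

text \<open>The axioms are those of \<^locale>\<open>module\<close>, which however requires a commutative base ring.\<close>

locale left_module = R?: ring R + M?: abelian_group M
  for R :: "('r, 'x) ring_scheme" and M :: "('r, 'm, 'y) module_scheme" (structure) +
  assumes lsmult_closed: "\<lbrakk>a \<in> carrier R; x \<in> carrier M\<rbrakk> \<Longrightarrow> a \<odot> x \<in> carrier M"
    and lsmult_l_distr:
      "\<lbrakk>a \<in> carrier R; b \<in> carrier R; x \<in> carrier M\<rbrakk>
        \<Longrightarrow> (a \<oplus>\<^bsub>R\<^esub> b) \<odot> x = a \<odot> x \<oplus> b \<odot> x"
    and lsmult_r_distr:
      "\<lbrakk>a \<in> carrier R; x \<in> carrier M; y \<in> carrier M\<rbrakk>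
        \<Longrightarrow> a \<odot> (x \<oplus> y) = a \<odot> x \<oplus> a \<odot> y"
    and lsmult_assoc:
      "\<lbrakk>a \<in> carrier R; b \<in> carrier R; x \<in> carrier M\<rbrakk>
        \<Longrightarrow> (a \<otimes>\<^bsub>R\<^esub> b) \<odot> x = a \<odot> (b \<odot> x)"
    and lsmult_one: "x \<in> carrier M \<Longrightarrow> \<one>\<^bsub>R\<^esub> \<odot> x = x"

definition restrict_scalars ::
    "('k, 'a, 'z) module_scheme \<Rightarrow> ('a, 'm) module \<Rightarrow> ('k, 'm) module" where
  "restrict_scalars A M =
     \<lparr>carrier = carrier M, mult = mult M, one = one M, zero = zero M, add = add M,
      smult = (\<lambda>c m. (c \<odot>\<^bsub>A\<^esub> \<one>\<^bsub>A\<^esub>) \<odot>\<^bsub>M\<^esub> m)\<rparr>"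

definition fd_left_module ::
    "('k, 'y) ring_scheme \<Rightarrow> ('k, 'a, 'z) module_scheme \<Rightarrow> ('a, 'm) module \<Rightarrow> bool" where
  "fd_left_module K A M \<longleftrightarrow>
     left_module A M \<and> vectorspace.fin_dim K (restrict_scalars A M)"

text \<open>\<^const>\<open>module_hom\<close> is a plain definition that does not require its base ring to be commutative.\<close>

definition modules_isomorphic ::
    "('r, 'x) ring_scheme \<Rightarrow> ('r, 'm, 'y) module_scheme \<Rightarrow> ('r, 'n, 'z) module_scheme \<Rightarrow> bool" where
  "modules_isomorphic R M N \<longleftrightarrow>
     (\<exists>f \<in> module_hom R M N. bij_betw f (carrier M) (carrier N))"

definition fd_module_iso_rel ::
    "('k, 'y) ring_scheme \<Rightarrow> ('k, 'a, 'z) module_scheme \<Rightarrow> ('a, 'm) module rel" where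
  "fd_module_iso_rel K A =
     {(M, N). fd_left_module K A M \<and> fd_left_module K A N \<and> modules_isomorphic A M N}"

definition left_ideal_module :: "('a, 'x) ring_scheme \<Rightarrow> 'a set \<Rightarrow> ('a, 'a) module" where
  "left_ideal_module R L =
     \<lparr>carrier = L, mult = mult R, one = one R, zero = zero R, add = add R, smult = mult R\<rparr>"

text \<open>
  As for \<^const>\<open>FactRing\<close>, the elements of the quotient are cosets.  The ring fields \<^const>\<open>mult\<close> and
  \<^const>\<open>one\<close> play no role for modules and are filled as in \<^const>\<open>FactRing\<close>.
\<close>

definition factor_module :: "('r, 'm, 'x) module_scheme \<Rightarrow> 'm set \<Rightarrow> ('r, 'm set) module" where
  "factor_module M N =
     \<lparr>carrier = a_rcosets\<^bsub>M\<^esub> N, mult = rcoset_mult M N, one = N +>\<^bsub>M\<^esub> \<one>\<^bsub>M\<^esub>,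
      zero = N, add = set_add M,
      smult = (\<lambda>r X. \<Union>x\<in>X. N +>\<^bsub>M\<^esub> (r \<odot>\<^bsub>M\<^esub> x))\<rparr>"


section \<open>Jacobson radical and ideal powers\<close>

definition left_ideal :: "'a set \<Rightarrow> ('a, 'x) ring_scheme \<Rightarrow> bool" where
  "left_ideal I R \<longleftrightarrow>
     additive_subgroup I R \<and> (\<forall>r \<in> carrier R. \<forall>x \<in> I. r \<otimes>\<^bsub>R\<^esub> x \<in> I)"

definition maximal_left_ideal :: "'a set \<Rightarrow> ('a, 'x) ring_scheme \<Rightarrow> bool" where
  "maximal_left_ideal I R \<longleftrightarrow>
     left_ideal I R \<and> I \<noteq> carrier R \<and>
     (\<forall>L. left_ideal L R \<and> I \<subseteq> L \<longrightarrow> L = I \<or> L = carrier R)"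

definition jacobson_radical :: "('a, 'x) ring_scheme \<Rightarrow> 'a set" where
  "jacobson_radical R = {x \<in> carrier R. \<forall>I. maximal_left_ideal I R \<longrightarrow> x \<in> I}"

primrec ideal_power :: "('a, 'x) ring_scheme \<Rightarrow> 'a set \<Rightarrow> nat \<Rightarrow> 'a set" where
  "ideal_power R I 0 = carrier R"
| "ideal_power R I (Suc m) = I \<cdot>\<^bsub>R\<^esub> ideal_power R I m"


section \<open>Idempotents; basic and split algebras\<close>

definition idempotent :: "('a, 'x) ring_scheme \<Rightarrow> 'a \<Rightarrow> bool" where
  "idempotent R x \<longleftrightarrow> x \<in> carrier R \<and> x \<otimes>\<^bsub>R\<^esub> x = x"

definition primitive_idempotent :: "('a, 'x) ring_scheme \<Rightarrow> 'a \<Rightarrow> bool" where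
  "primitive_idempotent R x \<longleftrightarrow>
     idempotent R x \<and> x \<noteq> \<zero>\<^bsub>R\<^esub> \<and>
     (\<forall>y z. idempotent R y \<and> idempotent R z \<and> y \<otimes>\<^bsub>R\<^esub> z = \<zero>\<^bsub>R\<^esub> \<and> z \<otimes>\<^bsub>R\<^esub> y = \<zero>\<^bsub>R\<^esub> \<and>
        x = y \<oplus>\<^bsub>R\<^esub> z \<longrightarrow> y = \<zero>\<^bsub>R\<^esub> \<or> z = \<zero>\<^bsub>R\<^esub>)"

definition complete_primitive_idempotents ::
    "('a, 'x) ring_scheme \<Rightarrow> nat \<Rightarrow> (nat \<Rightarrow> 'a) \<Rightarrow> bool" where
  "complete_primitive_idempotents R t e \<longleftrightarrow>
     (\<forall>h \<in> {1..t}. primitive_idempotent R (e h)) \<and>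
     (\<forall>h \<in> {1..t}. \<forall>l \<in> {1..t}. h \<noteq> l \<longrightarrow> e h \<otimes>\<^bsub>R\<^esub> e l = \<zero>\<^bsub>R\<^esub>) \<and>
     (\<Oplus>\<^bsub>R\<^esub>h \<in> {1..t}. e h) = \<one>\<^bsub>R\<^esub>"

definition principal_left :: "('a, 'x) ring_scheme \<Rightarrow> 'a \<Rightarrow> 'a set" where
  "principal_left R x = (\<lambda>r. r \<otimes>\<^bsub>R\<^esub> x) ` carrier R"

definition peirce :: "('a, 'x) ring_scheme \<Rightarrow> 'a \<Rightarrow> 'a set \<Rightarrow> 'a \<Rightarrow> 'a set" where
  "peirce R x S y = (\<lambda>s. x \<otimes>\<^bsub>R\<^esub> s \<otimes>\<^bsub>R\<^esub> y) ` S"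

definition basic_algebra :: "('a, 'x) ring_scheme \<Rightarrow> nat \<Rightarrow> (nat \<Rightarrow> 'a) \<Rightarrow> bool" where
  "basic_algebra R t e \<longleftrightarrow>
     (\<forall>h \<in> {1..t}. \<forall>l \<in> {1..t}. h \<noteq> l \<longrightarrow>
        \<not> modules_isomorphic R (left_ideal_module R (principal_left R (e h)))
                              (left_ideal_module R (principal_left R (e l))))"

definition corner :: "('k, 'a, 'z) module_scheme \<Rightarrow> 'a \<Rightarrow> ('k, 'a, 'z) module_scheme" where
  "corner A x = A\<lparr>carrier := peirce A x (carrier A) x, one := x\<rparr>"

text \<open>
  The isomorphism from the residue ring to the ground field is one of algebras over that field:
  a bare ring isomorphism would also allow proper extension fields abstractly isomorphic to it.
\<close>

definition split_algebra ::
    "('k, 'y) ring_scheme \<Rightarrow> ('k, 'a, 'z) module_scheme \<Rightarrow> nat \<Rightarrow> (nat \<Rightarrow> 'a) \<Rightarrow> bool" where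
  "split_algebra K A t e \<longleftrightarrow>
     (\<forall>h \<in> {1..t}.
        let C = corner A (e h); N = peirce A (e h) (jacobson_radical A) (e h)
        in \<exists>f \<in> ring_iso (C Quot N) K.
             \<forall>c \<in> carrier K. \<forall>x \<in> carrier C.
               f (N +>\<^bsub>C\<^esub> (c \<odot>\<^bsub>C\<^esub> x)) = c \<otimes>\<^bsub>K\<^esub> f (N +>\<^bsub>C\<^esub> x))"


section \<open>The terminal ambiguity fibre\<close>

definition grassmannian :: "('k, 'y) ring_scheme \<Rightarrow> ('k, 'a, 'z) module_scheme \<Rightarrow> nat \<Rightarrow> 'a set set" where
  "grassmannian K V r = {U. subspace K U V \<and> vectorspace.dim K (V\<lparr>carrier := U\<rparr>) = r}"

definition V_space ::
    "('k, 'a, 'z) module_scheme \<Rightarrow> nat \<Rightarrow> (nat \<Rightarrow> 'a) \<Rightarrow> nat \<Rightarrow> nat \<Rightarrow> ('k, 'a, 'z) module_scheme" where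
  "V_space A n e i j =
     A\<lparr>carrier := peirce A (e j) (ideal_power A (jacobson_radical A) (n - 1)) (e i)\<rparr>"

text \<open>The internal direct sum is the set of all sums of families of elements of the summands.\<close>

definition W_space ::
    "('a, 'x) ring_scheme \<Rightarrow> nat \<Rightarrow> nat \<Rightarrow> (nat \<Rightarrow> 'a) \<Rightarrow> nat \<Rightarrow> nat \<Rightarrow> 'a set" where
  "W_space R n t e i j =
     {(\<Oplus>\<^bsub>R\<^esub>h \<in> {1..t} - {j}. w h) | w.
        \<forall>h \<in> {1..t} - {j}.
          w h \<in> (\<lambda>x. e h \<otimes>\<^bsub>R\<^esub> x) `
                (ideal_power R (jacobson_radical R) (n - 1) \<cdot>\<^bsub>R\<^esub> principal_left R (e i))}"

definition K_sub ::
    "('a, 'x) ring_scheme \<Rightarrow> nat \<Rightarrow> nat \<Rightarrow> (nat \<Rightarrow> 'a) \<Rightarrow> nat \<Rightarrow> nat \<Rightarrow> 'a set \<Rightarrow> 'a set" where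
  "K_sub R n t e i j U = W_space R n t e i j <+>\<^bsub>R\<^esub> U"

definition M_mod ::
    "('a, 'x) ring_scheme \<Rightarrow> nat \<Rightarrow> nat \<Rightarrow> (nat \<Rightarrow> 'a) \<Rightarrow> nat \<Rightarrow> nat \<Rightarrow> 'a set \<Rightarrow> ('a, 'a set) module" where
  "M_mod R n t e i j U =
     factor_module (left_ideal_module R (principal_left R (e i))) (K_sub R n t e i j U)"

definition terminal_fibre ::
    "('k, 'y) ring_scheme \<Rightarrow> ('k, 'a, 'z) module_scheme \<Rightarrow> nat \<Rightarrow> nat \<Rightarrow> (nat \<Rightarrow> 'a) \<Rightarrow> nat \<Rightarrow> nat \<Rightarrow> nat
      \<Rightarrow> ('a, 'a set) module set set" where
  "terminal_fibre K A n t e i j s =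
     {M_mod A n t e i j U | U.
        U \<in> grassmannian K (V_space A n e i j) (vectorspace.dim K (V_space A n e i j) - s)}
     // fd_module_iso_rel K A"

end

theory Submission
  imports Defs
begin

text \<open>
  The fibre is by definition the set of isomorphism classes of the modules \<open>M\<^sub>U = P\<^sub>i/K\<^sub>U\<close>, so what has to
  be shown is that every \<open>M\<^sub>U\<close> is a module and that \<open>M\<^sub>U \<cong> M\<^sub>U\<^sub>'\<close> forces \<open>U = U'\<close>.  Everything rests on
  \<open>J J\<^sup>n\<^sup>-\<^sup>1 = 0 = J\<^sup>n\<^sup>-\<^sup>1 J\<close>.

  Because the algebra is basic and split, it is spanned modulo \<open>J\<close> by the idempotents \<open>e\<^sub>h\<close>: an
  element of \<open>e\<^sub>h A e\<^sub>h\<close> is a multiple of \<open>e\<^sub>h\<close> up to the radical (\<open>corner_decomposition\<close>), and an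
  element of \<open>e\<^sub>h A e\<^sub>l\<close> with \<open>h \<noteq> l\<close> that is not in \<open>J\<close> would give an isomorphism \<open>A e\<^sub>h \<cong> A e\<^sub>l\<close>
  (\<open>off_diagonal_in_J\<close>).  On \<open>J\<^sup>n\<^sup>-\<^sup>1 e\<^sub>i\<close>, where \<open>J\<close> acts as zero, an element of the algebra
  therefore just rescales the components at the different \<open>e\<^sub>h\<close>.  Hence \<open>K\<^sub>U\<close>, which consists of the
  elements of \<open>J\<^sup>n\<^sup>-\<^sup>1 e\<^sub>i\<close> with \<open>j\<close>-component in \<open>U\<close> (\<open>K_sub_eq\<close>), is a submodule
  (\<open>K_sub_left_ideal\<close>), and \<open>M\<^sub>U\<close> is a cyclic module, hence finite-dimensional.

  An isomorphism \<open>M\<^sub>U \<cong> M\<^sub>U\<^sub>'\<close> lifts to right multiplication on \<open>P\<^sub>i\<close> by an element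
  \<open>x \<in> e\<^sub>i A e\<^sub>i\<close>, and \<open>x = c e\<^sub>i + r\<close> with a scalar \<open>c\<close> and \<open>r \<in> J\<close>.  It multiplies \<open>V\<close> by \<open>c\<close>,
  because \<open>J\<^sup>n\<^sup>-\<^sup>1 r = 0\<close>.  If \<open>c \<noteq> 0\<close>, then \<open>U \<subseteq> U'\<close>.  If \<open>c = 0\<close>, surjectivity yields \<open>V \<subseteq> U'\<close>,
  which is impossible for positive codimension.  This is \<open>subset_of_M_mod_isomorphic\<close>;
  exchanging the roles of \<open>U\<close> and \<open>U'\<close> gives equality.
\<close>

section \<open>Left ideals, the Jacobson radical and its powers\<close>

context ring
begin

text \<open>
  Normalisation in a noncommutative ring: products are expanded and reassociated, sums are sorted,
  and a term cancels against an adjacent negative.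
\<close>
lemmas ring_expand =
  a_minus_def l_distr r_distr l_minus r_minus minus_add m_assoc a_ac l_neg r_neg r_neg1 r_neg2

lemma left_idealI:
  assumes "I \<subseteq> carrier R" and "\<zero> \<in> I"
    and "\<And>x y. \<lbrakk>x \<in> I; y \<in> I\<rbrakk> \<Longrightarrow> x \<oplus> y \<in> I"
    and mult: "\<And>r x. \<lbrakk>r \<in> carrier R; x \<in> I\<rbrakk> \<Longrightarrow> r \<otimes> x \<in> I"
  shows "left_ideal I R"
proof -
  have "\<ominus> x \<in> I" if "x \<in> I" for x
    using mult[of "\<ominus> \<one>" x] that assms(1) by (auto simp: l_minus)
  then have "additive_subgroup I R"
    using assms by (intro additive_subgroupI add.subgroupI) (auto simp: a_inv_def)
  then show ?thesis
    using mult by (simp add: left_ideal_def)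
qed

lemma
  assumes "left_ideal I R"
  shows left_ideal_carrier: "x \<in> I \<Longrightarrow> x \<in> carrier R"
    and left_ideal_zero: "\<zero> \<in> I"
    and left_ideal_add: "\<lbrakk>x \<in> I; y \<in> I\<rbrakk> \<Longrightarrow> x \<oplus> y \<in> I"
    and left_ideal_minus: "\<lbrakk>x \<in> I; y \<in> I\<rbrakk> \<Longrightarrow> x \<ominus> y \<in> I"
    and left_ideal_mult: "\<lbrakk>r \<in> carrier R; x \<in> I\<rbrakk> \<Longrightarrow> r \<otimes> x \<in> I"
  using assms
  by (auto simp: left_ideal_def a_minus_def additive_subgroup.a_Hcarr
      additive_subgroup.zero_closed additive_subgroup.a_closed additive_subgroup.a_inv_closed
      abelian_group_axioms)

lemma left_ideal_finsum:
  assumes L: "left_ideal L R" and "finite H" and "\<And>h. h \<in> H \<Longrightarrow> w h \<in> L"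
  shows "(\<Oplus>h \<in> H. w h) \<in> L"
  using assms(2,3)
proof (induction H rule: finite_induct)
  case empty
  then show ?case using left_ideal_zero[OF L] by simp
next
  case (insert h H)
  then show ?case
    using left_ideal_carrier[OF L] left_ideal_add[OF L] by (subst finsum_insert) auto
qed

lemma left_ideal_add_principal:
  assumes I: "left_ideal I R" and x: "x \<in> carrier R"
  shows "left_ideal {b \<otimes> x \<oplus> m | b m. b \<in> carrier R \<and> m \<in> I} R" (is "left_ideal ?L R")
proof (rule left_idealI)
  note c = left_ideal_carrier[OF I]
  show "?L \<subseteq> carrier R" using x c by auto
  have "\<zero> = \<zero> \<otimes> x \<oplus> \<zero>" using x by simp
  then show "\<zero> \<in> ?L" using left_ideal_zero[OF I] by blast
  show "y \<oplus> z \<in> ?L" if "y \<in> ?L" "z \<in> ?L" for y z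
  proof -
    from that obtain b m b' m' where *: "b \<in> carrier R" "b' \<in> carrier R" "m \<in> I" "m' \<in> I"
      "y = b \<otimes> x \<oplus> m" "z = b' \<otimes> x \<oplus> m'" by auto
    have "y \<oplus> z = (b \<oplus> b') \<otimes> x \<oplus> (m \<oplus> m')"
      unfolding * using * x c by (simp add: l_distr a_ac)
    then show ?thesis using * left_ideal_add[OF I] by blast
  qed
  show "r \<otimes> y \<in> ?L" if "r \<in> carrier R" "y \<in> ?L" for r y
  proof -
    from that obtain b m where *: "b \<in> carrier R" "m \<in> I" "y = b \<otimes> x \<oplus> m" by auto
    have "r \<otimes> y = (r \<otimes> b) \<otimes> x \<oplus> r \<otimes> m"
      unfolding * using * x c that by (simp add: r_distr m_assoc)
    then show ?thesis using * that left_ideal_mult[OF I] by blast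
  qed
qed

text \<open>This is the simplicity of \<open>R/I\<close>: every nonzero element generates it.\<close>
lemma maximal_left_ideal_decompose:
  assumes I: "maximal_left_ideal I R" and x: "x \<in> carrier R" "x \<notin> I" and y: "y \<in> carrier R"
  obtains b m where "b \<in> carrier R" "m \<in> I" "y = b \<otimes> x \<oplus> m"
proof -
  have LI: "left_ideal I R" using I by (simp add: maximal_left_ideal_def)
  let ?L = "{b \<otimes> x \<oplus> m | b m. b \<in> carrier R \<and> m \<in> I}"
  have "m = \<zero> \<otimes> x \<oplus> m" if "m \<in> I" for m
    using that x left_ideal_carrier[OF LI] by simp
  then have "I \<subseteq> ?L" by blast
  moreover have "x = \<one> \<otimes> x \<oplus> \<zero>" using x by simp
  then have "x \<in> ?L" using left_ideal_zero[OF LI] by blast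
  ultimately have "?L = carrier R"
    using I x(2) left_ideal_add_principal[OF LI x(1)] unfolding maximal_left_ideal_def by blast
  then show thesis using y that by blast
qed

lemma jacobson_radical_left_ideal: "left_ideal (jacobson_radical R) R"
  by (rule left_idealI)
    (auto simp: jacobson_radical_def maximal_left_ideal_def
      intro: left_ideal_zero left_ideal_add left_ideal_mult)

text \<open>
  If \<open>I\<close> is a maximal left ideal and \<open>a \<notin> I\<close>, then \<open>{b. ba \<in> I}\<close> is again a maximal left
  ideal, being the annihilator of the generator \<open>a + I\<close> of the simple module \<open>R/I\<close>.  Every element of
  the radical lies in it.
\<close>
lemma jacobson_radical_mult_right:
  assumes x: "x \<in> jacobson_radical R" and a: "a \<in> carrier R"
  shows "x \<otimes> a \<in> jacobson_radical R"
proof -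
  have xc: "x \<in> carrier R" using x by (simp add: jacobson_radical_def)
  have "x \<otimes> a \<in> I" if I: "maximal_left_ideal I R" for I
  proof (cases "a \<in> I")
    case True
    then show ?thesis using I xc left_ideal_mult by (auto simp: maximal_left_ideal_def)
  next
    case False
    have LI: "left_ideal I R" using I by (simp add: maximal_left_ideal_def)
    let ?L = "{b \<in> carrier R. b \<otimes> a \<in> I}"
    have L: "left_ideal ?L R"
      using a left_ideal_zero[OF LI] left_ideal_add[OF LI] left_ideal_mult[OF LI]
      by (intro left_idealI) (auto simp: l_distr m_assoc)
    have "L' = carrier R" if L': "left_ideal L' R" "?L \<subseteq> L'" "L' \<noteq> ?L" for L'
    proof -
      obtain b where b: "b \<in> L'" "b \<notin> ?L" using L' by blast
      have bc: "b \<in> carrier R" using b left_ideal_carrier[OF L'(1)] by blast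
      have "c \<in> L'" if c: "c \<in> carrier R" for c
      proof -
        obtain d m where d: "d \<in> carrier R" "m \<in> I" "c \<otimes> a = d \<otimes> (b \<otimes> a) \<oplus> m"
          using maximal_left_ideal_decompose[OF I, of "b \<otimes> a" "c \<otimes> a"] b a bc c by auto
        have "(c \<ominus> d \<otimes> b) \<otimes> a = c \<otimes> a \<ominus> d \<otimes> (b \<otimes> a)"
          using a bc c d by (simp add: a_minus_def l_distr l_minus m_assoc)
        also have "\<dots> = m"
          using d a bc left_ideal_carrier[OF LI d(2)] by (simp add: a_minus_def a_ac r_neg r_neg1 r_neg2)
        finally have "c \<ominus> d \<otimes> b \<in> L'" using L'(2) d bc c by auto
        then have "(c \<ominus> d \<otimes> b) \<oplus> d \<otimes> b \<in> L'"
          using left_ideal_add[OF L'(1)] left_ideal_mult[OF L'(1)] b d by blast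
        then show ?thesis using c d bc by (simp add: a_minus_def a_assoc l_neg)
      qed
      then show ?thesis using left_ideal_carrier[OF L'(1)] by blast
    qed
    moreover have "\<one> \<notin> ?L" using False a by simp
    then have "?L \<noteq> carrier R" by blast
    ultimately have "maximal_left_ideal ?L R" using L by (auto simp: maximal_left_ideal_def)
    then show ?thesis using x by (auto simp: jacobson_radical_def)
  qed
  then show ?thesis using xc a by (simp add: jacobson_radical_def)
qed

lemma left_ideal_prod:
  assumes I: "left_ideal I R" and L: "left_ideal L R"
  shows "left_ideal (I \<cdot> L) R"
proof (rule left_idealI)
  show sub: "I \<cdot> L \<subseteq> carrier R"
  proof
    show "x \<in> carrier R" if "x \<in> I \<cdot> L" for x
      using that by induct (auto intro: left_ideal_carrier[OF I] left_ideal_carrier[OF L])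
  qed
  show "\<zero> \<in> I \<cdot> L"
    using ideal_prod.prod[OF left_ideal_zero[OF I] left_ideal_zero[OF L], of R] by simp
  show "x \<oplus> y \<in> I \<cdot> L" if "x \<in> I \<cdot> L" "y \<in> I \<cdot> L" for x y
    using that by (rule ideal_prod.sum)
  show "r \<otimes> x \<in> I \<cdot> L" if r: "r \<in> carrier R" and x: "x \<in> I \<cdot> L" for r x
    using x
  proof induct
    case (prod a b)
    then have "r \<otimes> (a \<otimes> b) = (r \<otimes> a) \<otimes> b"
      using r left_ideal_carrier[OF I] left_ideal_carrier[OF L] m_assoc by metis
    then show ?case
      using ideal_prod.prod[OF left_ideal_mult[OF I r prod(1)] prod(2)] by metis
  next
    case (sum a b)
    then have "r \<otimes> (a \<oplus> b) = r \<otimes> a \<oplus> r \<otimes> b"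
      using r sub by (intro r_distr) auto
    then show ?case using ideal_prod.sum[OF sum(2,4)] by simp
  qed
qed

lemma left_ideal_carrier_self: "left_ideal (carrier R) R"
  by (rule left_idealI) auto

lemma ideal_power_left_ideal:
  assumes "left_ideal I R"
  shows "left_ideal (ideal_power R I m) R"
  by (induction m) (auto intro: left_ideal_prod[OF assms] left_ideal_carrier_self)

text \<open>
  The power ends in the factor \<open>I\<^sup>0 = R\<close>, hence absorbs multiplication on the right for every left
  ideal \<open>I\<close>.
\<close>
lemma ideal_power_mult_right:
  assumes I: "left_ideal I R" and a: "a \<in> carrier R"
  shows "x \<in> ideal_power R I m \<Longrightarrow> x \<otimes> a \<in> ideal_power R I m"
proof (induction m arbitrary: x)
  case (Suc m)
  note P = ideal_power_left_ideal[OF I, of m]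
  from Suc.prems have "x \<in> I \<cdot> ideal_power R I m" by simp
  then have "x \<otimes> a \<in> I \<cdot> ideal_power R I m"
  proof induct
    case (prod b c)
    then have "b \<otimes> c \<otimes> a = b \<otimes> (c \<otimes> a)"
      using a left_ideal_carrier[OF I] left_ideal_carrier[OF P] by (intro m_assoc)
    then show ?case
      using ideal_prod.prod[OF prod(1) Suc.IH[OF prod(2)]] by metis
  next
    case (sum b c)
    then have "(b \<oplus> c) \<otimes> a = b \<otimes> a \<oplus> c \<otimes> a"
      using a left_ideal_carrier[OF left_ideal_prod[OF I P]] by (intro l_distr)
    then show ?case using ideal_prod.sum[OF sum(2,4)] by simp
  qed
  then show ?case by simp
qed (use a in simp)

lemma ideal_power_Suc_mult_left:
  "\<lbrakk>x \<in> I; y \<in> ideal_power R I m\<rbrakk> \<Longrightarrow> x \<otimes> y \<in> ideal_power R I (Suc m)"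
  by (simp add: ideal_prod.prod)

text \<open>
  The powers are bracketed to the right, with the new factor on the left; a factor can nevertheless
  be appended on the right, where the base case \<open>R I \<subseteq> I R\<close> uses that \<open>I\<close> absorbs \<open>R\<close> from the left.
\<close>
lemma ideal_power_Suc_mult_right:
  assumes I: "left_ideal I R" and y: "y \<in> I"
  shows "x \<in> ideal_power R I m \<Longrightarrow> x \<otimes> y \<in> ideal_power R I (Suc m)"
proof (induction m arbitrary: x)
  case 0
  then have "x \<otimes> y \<in> I" using left_ideal_mult[OF I] y by simp
  then show ?case using ideal_prod.prod[of "x \<otimes> y" I \<one> "carrier R" R] left_ideal_carrier[OF I] by simp
next
  case (Suc m)
  note yc = left_ideal_carrier[OF I y] and P = ideal_power_left_ideal[OF I, of m]
  from Suc.prems have "x \<in> I \<cdot> ideal_power R I m" by simp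
  then have "x \<otimes> y \<in> I \<cdot> ideal_power R I (Suc m)"
  proof induct
    case (prod b c)
    then have "b \<otimes> c \<otimes> y = b \<otimes> (c \<otimes> y)"
      using yc left_ideal_carrier[OF I] left_ideal_carrier[OF P] by (intro m_assoc)
    then show ?case
      using ideal_prod.prod[OF prod(1) Suc.IH[OF prod(2)]] by metis
  next
    case (sum b c)
    then have "(b \<oplus> c) \<otimes> y = b \<otimes> y \<oplus> c \<otimes> y"
      using yc left_ideal_carrier[OF left_ideal_prod[OF I P]] by (intro l_distr)
    then show ?case using ideal_prod.sum[OF sum(2,4)] by simp
  qed
  then show ?case by simp
qed

text \<open>An idempotent equals all its powers, so a nilpotent ideal contains only the idempotent \<open>0\<close>.\<close>
lemma idempotent_in_ideal_power:
  assumes "idempotent R x" "x \<in> I"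
  shows "x \<in> ideal_power R I m"
proof (induction m)
  case (Suc m)
  then show ?case
    using ideal_power_Suc_mult_left[OF assms(2) Suc] assms(1) by (simp add: idempotent_def)
qed (use assms in \<open>simp add: idempotent_def\<close>)

text \<open>The inverse is the geometric series \<open>1 + r + \<dots> + r\<^sup>n\<^sup>-\<^sup>1\<close>.\<close>
lemma one_minus_nilpotent_invertible:
  assumes I: "left_ideal I R" and nil: "ideal_power R I n = {\<zero>}" and r: "r \<in> I"
  obtains g where "g \<in> carrier R" "(\<one> \<ominus> r) \<otimes> g = \<one>" "g \<otimes> (\<one> \<ominus> r) = \<one>"
proof -
  have rc: "r \<in> carrier R" using left_ideal_carrier[OF I r] .
  have "\<exists>g \<in> carrier R. (\<one> \<ominus> r) \<otimes> g = \<one> \<ominus> r [^] m \<and> g \<otimes> (\<one> \<ominus> r) = \<one> \<ominus> r [^] m" for m :: nat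
  proof (induction m)
    case 0
    then show ?case using rc by (intro bexI[of _ \<zero>]) (auto simp: a_minus_def r_neg)
  next
    case (Suc m)
    then obtain g where g: "g \<in> carrier R" "(\<one> \<ominus> r) \<otimes> g = \<one> \<ominus> r [^] m"
      "g \<otimes> (\<one> \<ominus> r) = \<one> \<ominus> r [^] m" by auto
    have pw: "r \<otimes> r [^] m = r [^] Suc m" by (rule nat_pow_Suc2[OF rc, symmetric])
    \<comment> \<open>The partial sums satisfy \<open>g\<^sub>m\<^sub>+\<^sub>1 = 1 + r g\<^sub>m\<close>.\<close>
    have tele: "(\<one> \<ominus> r) \<oplus> r \<otimes> (\<one> \<ominus> r [^] m) = \<one> \<ominus> r \<otimes> r [^] m"
    proof -
      have "r \<otimes> (\<one> \<ominus> r [^] m) = r \<ominus> r \<otimes> r [^] m"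
        using rc by (simp add: ring_expand)
      moreover have "(\<one> \<ominus> r) \<oplus> (r \<ominus> y) = \<one> \<ominus> y" if "y \<in> carrier R" for y
        using rc that by algebra
      ultimately show ?thesis using rc by simp
    qed
    have comm: "(\<one> \<ominus> r) \<otimes> r = r \<otimes> (\<one> \<ominus> r)" using rc by (simp add: ring_expand)
    have "(\<one> \<ominus> r) \<otimes> (\<one> \<oplus> r \<otimes> g) = (\<one> \<ominus> r) \<oplus> ((\<one> \<ominus> r) \<otimes> r) \<otimes> g"
      using rc g(1) by (simp add: ring_expand)
    also have "\<dots> = (\<one> \<ominus> r) \<oplus> r \<otimes> ((\<one> \<ominus> r) \<otimes> g)"
      unfolding comm using rc g(1) by (simp add: m_assoc)
    also have "\<dots> = \<one> \<ominus> r \<otimes> r [^] m"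
      unfolding g by (rule tele)
    finally have 1: "(\<one> \<ominus> r) \<otimes> (\<one> \<oplus> r \<otimes> g) = \<one> \<ominus> r [^] Suc m" unfolding pw .
    have "(\<one> \<oplus> r \<otimes> g) \<otimes> (\<one> \<ominus> r) = (\<one> \<ominus> r) \<oplus> r \<otimes> (g \<otimes> (\<one> \<ominus> r))"
      using rc g(1) by (simp add: ring_expand)
    also have "\<dots> = \<one> \<ominus> r \<otimes> r [^] m"
      unfolding g by (rule tele)
    finally have 2: "(\<one> \<oplus> r \<otimes> g) \<otimes> (\<one> \<ominus> r) = \<one> \<ominus> r [^] Suc m" unfolding pw .
    show ?case using 1 2 rc g by (intro bexI[of _ "\<one> \<oplus> r \<otimes> g"]) auto
  qed
  moreover have "r [^] m \<in> ideal_power R I m" for m :: nat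
    by (induction m) (use rc ideal_power_Suc_mult_right[OF I r] in auto)
  then have "r [^] n = \<zero>" using nil by blast
  then have "\<one> \<ominus> r [^] n = \<one>" by (simp add: a_minus_def)
  ultimately show thesis using that by metis
qed

end

section \<open>Modules over a noncommutative ring and their quotients\<close>

context ring
begin

lemma left_ideal_module_left_module:
  assumes L: "left_ideal L R"
  shows "left_module R (left_ideal_module R L)"
proof -
  note c = left_ideal_carrier[OF L]
  have "abelian_group (left_ideal_module R L)"
  proof (rule abelian_groupI)
    show "\<exists>y\<in>carrier (left_ideal_module R L).
        y \<oplus>\<^bsub>left_ideal_module R L\<^esub> x = \<zero>\<^bsub>left_ideal_module R L\<^esub>"
      if "x \<in> carrier (left_ideal_module R L)" for x
      using that left_ideal_minus[OF L left_ideal_zero[OF L], of x] c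
      by (intro bexI[of _ "\<zero> \<ominus> x"]) (auto simp: left_ideal_module_def a_minus_def l_neg)
  qed (auto simp: left_ideal_module_def c left_ideal_zero[OF L] left_ideal_add[OF L] a_ac)
  then show ?thesis
    by (intro left_module.intro left_module_axioms.intro)
      (auto simp: left_ideal_module_def c left_ideal_mult[OF L] l_distr r_distr m_assoc ring_axioms)
qed

lemma principal_left_left_ideal:
  assumes x: "x \<in> carrier R"
  shows "left_ideal (principal_left R x) R"
proof (rule left_idealI)
  show "\<zero> \<in> principal_left R x"
    unfolding principal_left_def using x by (intro image_eqI[of _ _ \<zero>]) auto
  show "y \<oplus> z \<in> principal_left R x" if "y \<in> principal_left R x" "z \<in> principal_left R x" for y z
    using that x unfolding principal_left_def
    by (auto simp: l_distr[symmetric] intro!: imageI)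
  show "r \<otimes> y \<in> principal_left R x" if "r \<in> carrier R" "y \<in> principal_left R x" for r y
    using that x unfolding principal_left_def
    by (auto simp: m_assoc[symmetric] intro!: imageI)
qed (use x in \<open>auto simp: principal_left_def\<close>)

text \<open>
  Membership in a left ideal generated by an idempotent becomes an equation, so that later arguments
  about such modules are computations in the ring.
\<close>
lemma principal_left_idempotent_iff:
  assumes "idempotent R x"
  shows "y \<in> principal_left R x \<longleftrightarrow> y \<in> carrier R \<and> y \<otimes> x = y"
  using assms by (auto simp: principal_left_def idempotent_def m_assoc image_iff) metis

end

context left_module
begin

definition left_submodule :: "'m set \<Rightarrow> bool" where
  "left_submodule N \<longleftrightarrow>
     additive_subgroup N M \<and> (\<forall>a \<in> carrier R. \<forall>x \<in> N. a \<odot> x \<in> N)"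

context
  fixes N
  assumes N: "left_submodule N"
begin

interpretation N: abelian_subgroup N M
  using N by (intro abelian_subgroupI3) (simp_all add: left_submodule_def M.abelian_group_axioms)

lemma factor_module_carrierE:
  assumes "X \<in> carrier (factor_module M N)"
  obtains x where "x \<in> carrier M" "X = N +> x"
  using assms by (auto simp: factor_module_def A_RCOSETS_def')

lemma factor_module_carrierI:
  "x \<in> carrier M \<Longrightarrow> N +> x \<in> carrier (factor_module M N)"
  by (auto simp: factor_module_def A_RCOSETS_def')

lemma factor_module_add:
  "\<lbrakk>x \<in> carrier M; y \<in> carrier M\<rbrakk>
    \<Longrightarrow> (N +> x) \<oplus>\<^bsub>factor_module M N\<^esub> (N +> y) = N +> (x \<oplus> y)"
  by (simp add: factor_module_def N.a_rcos_sum)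

lemma factor_module_zero_iff:
  "x \<in> carrier M \<Longrightarrow> N +> x = \<zero>\<^bsub>factor_module M N\<^esub> \<longleftrightarrow> x \<in> N"
  using N.a_rcos_self[of x] N.a_rcos_const[of x] by (auto simp: factor_module_def)

lemma factor_module_smult:
  assumes a: "a \<in> carrier R" and x: "x \<in> carrier M"
  shows "a \<odot>\<^bsub>factor_module M N\<^esub> (N +> x) = N +> (a \<odot> x)"
proof -
  have "N +> (a \<odot> y) = N +> (a \<odot> x)" if y: "y \<in> N +> x" for y
  proof -
    obtain h where h: "h \<in> N" "y = h \<oplus> x" using y by (auto simp: a_r_coset_def')
    have "a \<odot> y = a \<odot> h \<oplus> a \<odot> x" using h a x by (simp add: lsmult_r_distr)
    moreover have "a \<odot> h \<in> N" using N a h by (simp add: left_submodule_def)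
    ultimately have "a \<odot> y \<in> N +> (a \<odot> x)" by (auto simp: a_r_coset_def')
    then show ?thesis using N.a_repr_independence'[OF _ lsmult_closed[OF a x]] by simp
  qed
  then have "(\<Union>y \<in> N +> x. N +> (a \<odot> y)) = (\<Union>y \<in> N +> x. N +> (a \<odot> x))"
    by (intro SUP_cong) simp_all
  also have "\<dots> = N +> (a \<odot> x)" using N.a_rcos_self[OF x] by blast
  finally show ?thesis by (simp add: factor_module_def)
qed

lemma factor_module_left_module: "left_module R (factor_module M N)"
proof -
  have "abelian_group (factor_module M N)"
  proof -
    have zero: "\<zero>\<^bsub>factor_module M N\<^esub> = N +> \<zero>"
      using factor_module_zero_iff[of \<zero>] by simp
    have inv: "(N +> (\<ominus> x)) \<oplus>\<^bsub>factor_module M N\<^esub> (N +> x) = \<zero>\<^bsub>factor_module M N\<^esub>"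
      if "x \<in> carrier M" for x
      using that by (simp add: factor_module_add M.l_neg zero)
    show ?thesis
    proof (rule abelian_groupI)
      show "\<exists>Y \<in> carrier (factor_module M N). Y \<oplus>\<^bsub>factor_module M N\<^esub> X = \<zero>\<^bsub>factor_module M N\<^esub>"
        if "X \<in> carrier (factor_module M N)" for X
        using that inv by (elim factor_module_carrierE) (auto intro: factor_module_carrierI)
    qed (auto elim!: factor_module_carrierE
        simp: zero factor_module_add factor_module_carrierI M.a_ac)
  qed
  moreover have "left_module_axioms R (factor_module M N)"
    by (rule left_module_axioms.intro; (elim factor_module_carrierE)?)
      (simp_all add: factor_module_carrierI factor_module_smult factor_module_add
        lsmult_closed lsmult_l_distr lsmult_r_distr lsmult_assoc lsmult_one R.ring_axioms)
  ultimately show ?thesis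
    by (intro left_module.intro) (simp_all add: R.ring_axioms)
qed

end

end

text \<open>A cyclic module is the image of the algebra under the linear map \<open>a \<mapsto> a m\<close>.\<close>
lemma (in fd_algebra) cyclic_fd_left_module:
  assumes M: "left_module A M" and m: "m \<in> carrier M"
    and gen: "\<And>x. x \<in> carrier M \<Longrightarrow> \<exists>a \<in> carrier A. x = a \<odot>\<^bsub>M\<^esub> m"
  shows "fd_left_module K A M"
proof -
  interpret M: left_module A M by (rule M)
  let ?W = "restrict_scalars A M"
  have "abelian_group ?W"
    by (rule abelian_groupI)
      (auto simp: restrict_scalars_def M.M.a_ac intro: bexI[of _ "\<ominus>\<^bsub>M\<^esub> _"] M.M.l_neg)
  then have "module K ?W"
    apply (intro moduleI)
          apply (simp_all add: restrict_scalars_def module.R.is_cring M.lsmult_closed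
        M.lsmult_r_distr M.lsmult_one smult_l_distr M.lsmult_l_distr flip: M.lsmult_assoc)
     apply (simp_all add: smult_mult_left smult_assoc1)
    done
  then have W: "vectorspace K ?W" by (simp add: vectorspace_def field_axioms)
  have "linear_map K A ?W (\<lambda>a. a \<odot>\<^bsub>M\<^esub> m)"
    unfolding linear_map_def mod_hom_def mod_hom_axioms_def module_hom_def
    using W m \<open>module K ?W\<close>
    by (auto simp: vectorspace_axioms module_axioms restrict_scalars_def M.lsmult_closed M.lsmult_l_distr
      smult_mult_left simp flip: M.lsmult_assoc)
  then have "vectorspace.fin_dim K ?W"
    using finite_dim gen m M.lsmult_closed
    by (intro linear_map.surj_fin_dim[of K A ?W "\<lambda>a. a \<odot>\<^bsub>M\<^esub> m"]) (auto simp: restrict_scalars_def)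
  then show ?thesis using M by (simp add: fd_left_module_def)
qed

section \<open>Off-diagonal Peirce components of a basic split algebra\<close>

locale nilpotent_basic_split_algebra = fd_algebra K A for K and A (structure) +
  fixes n t :: nat and e :: "nat \<Rightarrow> 'c"
  assumes n_pos: "n \<ge> 1"
    and nilpotent: "ideal_power A (jacobson_radical A) n = {\<zero>}"
    and idempotents: "complete_primitive_idempotents A t e"
    and basic: "basic_algebra A t e"
    and split: "split_algebra K A t e"
begin

abbreviation (input) J where "J \<equiv> jacobson_radical A"

lemmas J_left_ideal = jacobson_radical_left_ideal

lemma idem: "h \<in> {1..t} \<Longrightarrow> idempotent A (e h)"
  using idempotents by (simp add: complete_primitive_idempotents_def primitive_idempotent_def)

lemma
  assumes "h \<in> {1..t}"
  shows e_carrier: "e h \<in> carrier A" and e_idem: "e h \<otimes> e h = e h"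
  using idem[OF assms] by (simp_all add: idempotent_def)

lemma e_orthogonal: "\<lbrakk>h \<in> {1..t}; l \<in> {1..t}; h \<noteq> l\<rbrakk> \<Longrightarrow> e h \<otimes> e l = \<zero>"
  using idempotents by (simp add: complete_primitive_idempotents_def)

lemma e_sum: "(\<Oplus>h \<in> {1..t}. e h) = \<one>"
  using idempotents by (simp add: complete_primitive_idempotents_def)

lemma e_notin_J:
  assumes h: "h \<in> {1..t}"
  shows "e h \<notin> J"
proof
  assume "e h \<in> J"
  then have "e h = \<zero>" using idempotent_in_ideal_power[OF idem[OF h]] nilpotent by blast
  then show False
    using idempotents h by (simp add: complete_primitive_idempotents_def primitive_idempotent_def)
qed

lemma smult_J:
  assumes c: "c \<in> carrier K" and r: "r \<in> J"
  shows "c \<odot> r \<in> J"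
proof -
  have "c \<odot> r = (c \<odot> \<one>) \<otimes> r"
    using c left_ideal_carrier[OF J_left_ideal r] by (simp add: smult_mult_left)
  then show ?thesis using left_ideal_mult[OF J_left_ideal _ r] c by simp
qed

text \<open>
  This is how splitness enters: the corner \<open>e\<^sub>h A e\<^sub>h\<close> is \<open>K e\<^sub>h\<close> up to the radical.  The
  splitting isomorphism sends \<open>e\<^sub>h\<close> to \<open>1\<close>, so \<open>x\<close> and \<open>c e\<^sub>h\<close> have the same image when \<open>c\<close> is
  the image of \<open>x\<close>.
\<close>
lemma corner_decomposition:
  assumes h: "h \<in> {1..t}" and x: "x \<in> carrier A" "e h \<otimes> x = x" "x \<otimes> e h = x"
  obtains c r where "c \<in> carrier K" "r \<in> J" "e h \<otimes> r = r" "r \<otimes> e h = r" "x = c \<odot> e h \<oplus> r"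
proof -
  note eh = e_carrier[OF h] e_idem[OF h]
  let ?C = "corner A (e h)" and ?N = "peirce A (e h) J (e h)"
  obtain f where f: "f \<in> ring_iso (?C Quot ?N) K"
    and lin: "\<And>c x. \<lbrakk>c \<in> carrier K; x \<in> carrier ?C\<rbrakk>
      \<Longrightarrow> f (?N +>\<^bsub>?C\<^esub> (c \<odot>\<^bsub>?C\<^esub> x)) = c \<otimes>\<^bsub>K\<^esub> f (?N +>\<^bsub>?C\<^esub> x)"
    using split h unfolding split_algebra_def Let_def by blast
  have corner_iff: "y \<in> carrier ?C" if "y \<in> carrier A" "e h \<otimes> y = y" "y \<otimes> e h = y" for y
    using that by (auto simp: corner_def peirce_def image_iff intro!: bexI[of _ y])
  have coset: "?N +>\<^bsub>?C\<^esub> y = (\<Union>r \<in> ?N. {r \<oplus> y})" for y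
    by (simp add: a_r_coset_def' corner_def)
  have coset_in: "?N +>\<^bsub>?C\<^esub> y \<in> carrier (?C Quot ?N)" if "y \<in> carrier ?C" for y
    using that by (auto simp: FactRing_def A_RCOSETS_def')
  define c where "c = f (?N +>\<^bsub>?C\<^esub> x)"
  have xC: "x \<in> carrier ?C" and eC: "e h \<in> carrier ?C"
    using corner_iff x eh by auto
  have c: "c \<in> carrier K"
    using ring_iso_memE(1)[OF f coset_in[OF xC]] by (simp add: c_def)
  have ceC: "c \<odot> e h \<in> carrier ?C"
    using c eh by (intro corner_iff) (simp_all add: smult_mult_left smult_mult_right)
  have "f (?N +>\<^bsub>?C\<^esub> e h) = \<one>\<^bsub>K\<^esub>"
    using ring_iso_memE(4)[OF f] by (simp add: FactRing_def corner_def)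
  then have "f (?N +>\<^bsub>?C\<^esub> (c \<odot> e h)) = f (?N +>\<^bsub>?C\<^esub> x)"
    using lin[OF c eC] c by (simp add: corner_def c_def)
  moreover have "inj_on f (carrier (?C Quot ?N))"
    using ring_iso_memE(5)[OF f] by (simp add: bij_betw_def)
  ultimately have eq: "?N +>\<^bsub>?C\<^esub> (c \<odot> e h) = ?N +>\<^bsub>?C\<^esub> x"
    using coset_in[OF ceC] coset_in[OF xC] by (auto dest: inj_onD)
  have "e h \<otimes> \<zero> \<otimes> e h = \<zero>" using eh by simp
  then have "\<zero> \<in> ?N"
    using left_ideal_zero[OF J_left_ideal] unfolding peirce_def by (metis image_eqI)
  then have "x \<in> ?N +>\<^bsub>?C\<^esub> x" using x unfolding coset by (auto intro!: bexI[of _ \<zero>])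
  then have "x \<in> ?N +>\<^bsub>?C\<^esub> (c \<odot> e h)" by (simp only: eq)
  then obtain r where r: "r \<in> ?N" "x = r \<oplus> c \<odot> e h"
    unfolding coset by auto
  then obtain r' where r': "r' \<in> J" "r = e h \<otimes> r' \<otimes> e h" by (auto simp: peirce_def)
  have "r \<in> J"
    unfolding r'(2) using r'(1) eh left_ideal_mult[OF J_left_ideal] jacobson_radical_mult_right by blast
  moreover have "e h \<otimes> r = r" "r \<otimes> e h = r"
    unfolding r'(2) using eh left_ideal_carrier[OF J_left_ideal r'(1)]
    by (simp_all add: m_assoc, simp add: m_assoc[symmetric])
  moreover have "x = c \<odot> e h \<oplus> r"
    using r(2) c eh left_ideal_carrier[OF J_left_ideal \<open>r \<in> J\<close>] by (simp add: a_comm)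
  ultimately show thesis using c that by blast
qed

text \<open>
  Up to the scalar \<open>c\<close> the element is \<open>e\<^sub>h(1 - s)\<close> with \<open>s = -c\<^sup>-\<^sup>1r\<close> in the nilpotent radical, and
  \<open>1 - s\<close> is invertible.
\<close>
lemma corner_unit:
  assumes h: "h \<in> {1..t}" and c: "c \<in> carrier K" "c \<noteq> \<zero>\<^bsub>K\<^esub>"
    and r: "r \<in> J" "e h \<otimes> r = r" "r \<otimes> e h = r"
  obtains g where "g \<in> carrier A" "(c \<odot> e h \<oplus> r) \<otimes> g = e h" "g \<otimes> (c \<odot> e h \<oplus> r) = e h"
proof -
  note eh = e_carrier[OF h] and rc = left_ideal_carrier[OF J_left_ideal r(1)]
  have "c \<in> Units K" using c by (simp add: field_Units)
  then obtain d where d: "d \<in> carrier K" "c \<otimes>\<^bsub>K\<^esub> d = \<one>\<^bsub>K\<^esub>" "d \<otimes>\<^bsub>K\<^esub> c = \<one>\<^bsub>K\<^esub>"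
    by (auto simp: Units_def)
  define s where "s = \<ominus> (d \<odot> r)"
  have s: "s \<in> J" "s \<in> carrier A" "e h \<otimes> s = s" "s \<otimes> e h = s"
    using smult_J[OF d(1) r(1)] left_ideal_minus[OF J_left_ideal left_ideal_zero[OF J_left_ideal], of "d \<odot> r"]
      d rc r eh
    by (simp_all add: s_def a_minus_def l_minus r_minus smult_mult_left smult_mult_right)
  obtain g where g: "g \<in> carrier A" "(\<one> \<ominus> s) \<otimes> g = \<one>" "g \<otimes> (\<one> \<ominus> s) = \<one>"
    using one_minus_nilpotent_invertible[OF J_left_ideal nilpotent s(1)] .
  have "c \<odot> (d \<odot> r) = r"
    using c d rc by (simp flip: smult_assoc1)
  then have z: "c \<odot> e h \<oplus> r = c \<odot> (e h \<ominus> s)"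
    using c d rc eh by (simp add: s_def a_minus_def smult_r_distr minus_minus)
  have zl: "e h \<ominus> s = e h \<otimes> (\<one> \<ominus> s)" and zr: "e h \<ominus> s = (\<one> \<ominus> s) \<otimes> e h"
    using s eh by (simp_all add: a_minus_def r_distr l_distr l_minus r_minus)
  have 1: "(e h \<ominus> s) \<otimes> g = e h"
    unfolding zl using s eh g by (simp add: m_assoc)
  have 2: "g \<otimes> (e h \<ominus> s) = e h"
    unfolding zr using s eh g by (simp add: m_assoc[symmetric])
  have es: "e h \<ominus> s \<in> carrier A" using s eh by simp
  show thesis
  proof (rule that[of "d \<odot> g"])
    show "(c \<odot> e h \<oplus> r) \<otimes> (d \<odot> g) = e h"
      unfolding z using c d g es eh 1
      by (simp add: smult_mult_left smult_mult_right flip: smult_assoc1)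
    show "(d \<odot> g) \<otimes> (c \<odot> e h \<oplus> r) = e h"
      unfolding z using c d g es eh 2
      by (simp add: smult_mult_left smult_mult_right flip: smult_assoc1)
  qed (use d g in simp)
qed

text \<open>
  The isomorphism is right multiplication by \<open>x\<close>: a right inverse of \<open>xy\<close> makes it injective, and a
  left inverse of \<open>yx\<close> makes it surjective.
\<close>
lemma principal_left_iso_of_mutual_inverse:
  assumes h: "h \<in> {1..t}" and l: "l \<in> {1..t}"
    and x: "x \<in> carrier A" "x \<otimes> e l = x" and y: "y \<in> carrier A" "y \<otimes> e h = y"
    and xy: "g \<in> carrier A" "(x \<otimes> y) \<otimes> g = e h"
    and yx: "k \<in> carrier A" "k \<otimes> (y \<otimes> x) = e l"
  shows "modules_isomorphic A (left_ideal_module A (principal_left A (e h)))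
    (left_ideal_module A (principal_left A (e l)))"
proof -
  note eh = e_carrier[OF h] and el = e_carrier[OF l]
  let ?P = "\<lambda>h. principal_left A (e h)"
  have P: "p \<in> ?P m \<longleftrightarrow> p \<in> carrier A \<and> p \<otimes> e m = p" if "m \<in> {1..t}" for p m
    using principal_left_idempotent_iff[OF idem[OF that]] .
  have inj: "p = q" if "p \<in> ?P h" "q \<in> ?P h" "p \<otimes> x = q \<otimes> x" for p q
  proof -
    have pq: "p \<in> carrier A" "q \<in> carrier A" "p \<otimes> e h = p" "q \<otimes> e h = q"
      using that P[OF h] by auto
    have "p \<otimes> ((x \<otimes> y) \<otimes> g) = (p \<otimes> x) \<otimes> (y \<otimes> g)"
      using pq x y xy(1) by (simp add: m_assoc)
    also have "\<dots> = (q \<otimes> x) \<otimes> (y \<otimes> g)" using that by simp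
    also have "\<dots> = q \<otimes> ((x \<otimes> y) \<otimes> g)"
      using pq x y xy(1) by (simp add: m_assoc)
    finally show ?thesis unfolding xy(2) using pq by simp
  qed
  have into: "p \<otimes> x \<in> ?P l" if "p \<in> ?P h" for p
    using that x el P[OF h] P[OF l] by (auto simp: m_assoc)
  have onto: "\<exists>p \<in> ?P h. q = p \<otimes> x" if "q \<in> ?P l" for q
  proof
    have q: "q \<in> carrier A" "q \<otimes> e l = q" using that P[OF l] by auto
    have "q = q \<otimes> (k \<otimes> (y \<otimes> x))" unfolding yx(2) using q by simp
    then show "q = (q \<otimes> k \<otimes> y) \<otimes> x" using q(1) x y yx(1) by (simp add: m_assoc)
    show "q \<otimes> k \<otimes> y \<in> ?P h" using P[OF h] q y yx(1) eh by (auto simp: m_assoc)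
  qed
  have "bij_betw (\<lambda>p. p \<otimes> x) (?P h) (?P l)"
    unfolding bij_betw_def inj_on_def using inj into onto by blast
  moreover have "(\<lambda>p. p \<otimes> x) \<in> module_hom A (left_ideal_module A (?P h)) (left_ideal_module A (?P l))"
    using into x P[OF h] by (auto simp: module_hom_def left_ideal_module_def l_distr m_assoc)
  ultimately show ?thesis
    by (auto simp: modules_isomorphic_def left_ideal_module_def)
qed

text \<open>
  This is how basicness enters.  If \<open>x = e\<^sub>h a e\<^sub>l\<close> avoided some maximal left ideal, then some
  \<open>y \<in> e\<^sub>l A e\<^sub>h\<close> would make \<open>yx\<close> nonzero modulo the radical, hence a unit of the corner at \<open>e\<^sub>l\<close>
  because the algebra is split.  Then \<open>xy\<close> is a unit of the corner at \<open>e\<^sub>h\<close> as well, since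
  \<open>(yx)\<^sup>2 = y(xy)x\<close> does not lie in the radical, and right multiplication by \<open>x\<close> is an
  isomorphism \<open>A e\<^sub>h \<cong> A e\<^sub>l\<close>, which a basic algebra does not have.
\<close>
lemma off_diagonal_in_J:
  assumes h: "h \<in> {1..t}" and l: "l \<in> {1..t}" and hl: "h \<noteq> l" and a: "a \<in> carrier A"
  shows "e h \<otimes> a \<otimes> e l \<in> J"
proof (rule ccontr)
  define x where "x = e h \<otimes> a \<otimes> e l"
  assume "e h \<otimes> a \<otimes> e l \<notin> J"
  then have nx: "x \<notin> J" by (simp add: x_def)
  note eh = e_carrier[OF h] and el = e_carrier[OF l]
  have x: "x \<in> carrier A" "x \<otimes> e l = x" "e h \<otimes> x = x"
    using a eh el e_idem[OF h] e_idem[OF l] unfolding x_def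
    by (simp_all add: m_assoc, simp add: m_assoc[symmetric])
  obtain I where I: "maximal_left_ideal I A" "x \<notin> I"
    using nx x by (auto simp: jacobson_radical_def)
  have LI: "left_ideal I A" using I by (simp add: maximal_left_ideal_def)
  have JI: "J \<subseteq> I" using I by (auto simp: jacobson_radical_def)
  have eI: "e l \<notin> I" using left_ideal_mult[OF LI x(1), of "e l"] x I by auto
  obtain b m where b: "b \<in> carrier A" "m \<in> I" "e l = b \<otimes> x \<oplus> m"
    using maximal_left_ideal_decompose[OF I(1) x(1) I(2) el] .
  define y where "y = e l \<otimes> b \<otimes> e h"
  have y: "y \<in> carrier A" "y \<otimes> e h = y" "e l \<otimes> y = y"
    using b eh el e_idem[OF h] e_idem[OF l] unfolding y_def
    by (simp_all add: m_assoc, simp add: m_assoc[symmetric])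
  have "e l = e l \<otimes> (b \<otimes> x \<oplus> m)" using e_idem[OF l] b(3) by simp
  also have "\<dots> = y \<otimes> x \<oplus> e l \<otimes> m"
    using b el eh x left_ideal_carrier[OF LI b(2)] by (simp add: y_def m_assoc r_distr)
  finally have eyx: "e l = y \<otimes> x \<oplus> e l \<otimes> m" .
  have yx_notin: "y \<otimes> x \<notin> I"
    using eyx eI left_ideal_add[OF LI _ left_ideal_mult[OF LI el b(2)]] by metis
  obtain c r where c: "c \<in> carrier K" "r \<in> J" "e l \<otimes> r = r" "r \<otimes> e l = r"
    "y \<otimes> x = c \<odot> e l \<oplus> r"
    using corner_decomposition[OF l, of "y \<otimes> x"] x y el
    by (auto simp: m_assoc) (metis m_assoc)
  have "c \<noteq> \<zero>\<^bsub>K\<^esub>"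
    using c(2,5) yx_notin JI el left_ideal_carrier[OF J_left_ideal c(2)] by auto
  then obtain g where g: "g \<in> carrier A" "g \<otimes> (y \<otimes> x) = e l"
    using corner_unit[OF l c(1) _ c(2-4)] unfolding c(5) by metis
  obtain d s where d: "d \<in> carrier K" "s \<in> J" "e h \<otimes> s = s" "s \<otimes> e h = s"
    "x \<otimes> y = d \<odot> e h \<oplus> s"
    using corner_decomposition[OF h, of "x \<otimes> y"] x y eh
    by (auto simp: m_assoc) (metis m_assoc)
  have "d \<noteq> \<zero>\<^bsub>K\<^esub>"
  proof
    assume "d = \<zero>\<^bsub>K\<^esub>"
    then have "x \<otimes> y \<in> J"
      using d(2,5) eh left_ideal_carrier[OF J_left_ideal d(2)] by simp
    then have "y \<otimes> ((x \<otimes> y) \<otimes> x) \<in> J"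
      using jacobson_radical_mult_right left_ideal_mult[OF J_left_ideal] x y by blast
    then have "g \<otimes> (g \<otimes> (y \<otimes> ((x \<otimes> y) \<otimes> x))) \<in> J"
      using left_ideal_mult[OF J_left_ideal] g by blast
    moreover have "g \<otimes> (g \<otimes> (y \<otimes> ((x \<otimes> y) \<otimes> x))) = g \<otimes> ((g \<otimes> (y \<otimes> x)) \<otimes> (y \<otimes> x))"
      using g(1) x y by (simp add: m_assoc)
    moreover have "e l \<otimes> (y \<otimes> x) = y \<otimes> x"
      using x y el by (simp flip: m_assoc)
    ultimately show False using g e_notin_J[OF l] by simp
  qed
  then obtain k where k: "k \<in> carrier A" "(x \<otimes> y) \<otimes> k = e h"
    using corner_unit[OF h d(1) _ d(2-4)] unfolding d(5) by metis
  have "modules_isomorphic A (left_ideal_module A (principal_left A (e h)))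
      (left_ideal_module A (principal_left A (e l)))"
    using principal_left_iso_of_mutual_inverse[OF h l x(1,2) y(1,2) k g] .
  then show False using basic h l hl by (auto simp: basic_algebra_def)
qed

end

section \<open>The layer killed by the radical on both sides\<close>

context nilpotent_basic_split_algebra
begin

abbreviation (input) S where "S \<equiv> ideal_power A J (n - 1)"

lemmas S_left_ideal = ideal_power_left_ideal[OF J_left_ideal, of "n - 1"]
lemmas S_mult_right = ideal_power_mult_right[OF J_left_ideal, of _ _ "n - 1"]
lemmas S_carrier = left_ideal_carrier[OF S_left_ideal]

lemma J_S_zero: "\<lbrakk>r \<in> J; x \<in> S\<rbrakk> \<Longrightarrow> r \<otimes> x = \<zero>"
  using ideal_power_Suc_mult_left[of r J x "n - 1"] nilpotent n_pos by simp

lemma S_J_zero: "\<lbrakk>x \<in> S; r \<in> J\<rbrakk> \<Longrightarrow> x \<otimes> r = \<zero>"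
  using ideal_power_Suc_mult_right[OF J_left_ideal, of r x "n - 1"] nilpotent n_pos by simp

lemma S_mult_principal:
  assumes i: "i \<in> {1..t}"
  shows "S \<cdot> principal_left A (e i) = {x \<in> S. x \<otimes> e i = x}"
proof (rule Set.set_eqI)
  note P = principal_left_idempotent_iff[OF idem[OF i]]
  fix x
  have "x \<in> {x \<in> S. x \<otimes> e i = x}" if "x \<in> S \<cdot> principal_left A (e i)"
    using that
  proof induct
    case (prod s p)
    then show ?case using P e_carrier[OF i] S_carrier[of s] S_mult_right by (simp add: m_assoc)
  next
    case (sum s s')
    then show ?case
      using e_carrier[OF i] S_carrier left_ideal_add[OF S_left_ideal] by (simp add: l_distr)
  qed
  moreover have "x \<in> S \<cdot> principal_left A (e i)" if "x \<in> S" "x \<otimes> e i = x"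
    using ideal_prod.prod[OF that(1), of "e i" "principal_left A (e i)" A]
      that P e_carrier[OF i] e_idem[OF i] by simp
  ultimately show "x \<in> S \<cdot> principal_left A (e i) \<longleftrightarrow> x \<in> {x \<in> S. x \<otimes> e i = x}" by blast
qed

context
  fixes i j :: nat
  assumes i: "i \<in> {1..t}" and j: "j \<in> {1..t}"
begin

lemmas ei = e_carrier[OF i] e_idem[OF i] and ej = e_carrier[OF j] e_idem[OF j]

abbreviation (input) V where "V \<equiv> V_space A n e i j"
abbreviation (input) P where "P \<equiv> left_ideal_module A (principal_left A (e i))"

lemma V_iff: "v \<in> carrier V \<longleftrightarrow> v \<in> S \<and> e j \<otimes> v = v \<and> v \<otimes> e i = v"
proof -
  have "e j \<otimes> s \<otimes> e i \<in> S \<and> e j \<otimes> (e j \<otimes> s \<otimes> e i) = e j \<otimes> s \<otimes> e i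
    \<and> e j \<otimes> s \<otimes> e i \<otimes> e i = e j \<otimes> s \<otimes> e i" if "s \<in> S" for s
    using that S_carrier[OF that] ei ej left_ideal_mult[OF S_left_ideal] S_mult_right
    by (simp add: m_assoc, simp add: m_assoc[symmetric])
  moreover have "v \<in> peirce A (e j) S (e i)" if "v \<in> S" "e j \<otimes> v = v" "v \<otimes> e i = v"
    using that by (auto simp: peirce_def image_iff intro!: bexI[of _ v])
  ultimately show ?thesis by (auto simp: V_space_def peirce_def)
qed

lemma sum_e_mult:
  assumes "x \<in> carrier A"
  shows "x = e j \<otimes> x \<oplus> (\<Oplus>h \<in> {1..t} - {j}. e h \<otimes> x)"
proof -
  have "x = (\<Oplus>h \<in> {1..t}. e h) \<otimes> x" using assms e_sum by simp
  also have "\<dots> = (\<Oplus>h \<in> {1..t}. e h \<otimes> x)"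
    using assms e_carrier by (intro finsum_ldistr) auto
  also have "\<dots> = (\<Oplus>h \<in> insert j ({1..t} - {j}). e h \<otimes> x)" using j by (simp add: insert_absorb)
  also have "\<dots> = e j \<otimes> x \<oplus> (\<Oplus>h \<in> {1..t} - {j}. e h \<otimes> x)"
    using assms e_carrier j by (intro finsum_insert) auto
  finally show ?thesis .
qed

text \<open>
  Since the \<open>e\<^sub>h\<close> sum to \<open>1\<close>, the family of components in the definition is determined by its sum,
  and the only condition left is that the \<open>j\<close>-component vanishes.
\<close>
lemma W_space_eq: "W_space A n t e i j = {x \<in> S. x \<otimes> e i = x \<and> e j \<otimes> x = \<zero>}"
proof (intro Set.set_eqI iffI)
  let ?H = "{1..t} - {j}"
  fix x
  assume "x \<in> W_space A n t e i j"
  then obtain w where w: "x = (\<Oplus>h \<in> ?H. w h)"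
    "\<And>h. h \<in> ?H \<Longrightarrow> w h \<in> (\<lambda>x. e h \<otimes> x) ` {x \<in> S. x \<otimes> e i = x}"
    unfolding W_space_def S_mult_principal[OF i] by blast
  have wh: "w h \<in> S \<and> w h \<otimes> e i = w h \<and> e j \<otimes> w h = \<zero>" if h: "h \<in> ?H" for h
  proof -
    obtain s where s: "s \<in> S" "s \<otimes> e i = s" "w h = e h \<otimes> s" using w(2)[OF h] by auto
    have eh: "e h \<in> carrier A" "e j \<otimes> e h = \<zero>" using h e_carrier e_orthogonal[OF j] by auto
    have "e j \<otimes> w h = (e j \<otimes> e h) \<otimes> s"
      unfolding s(3) using eh(1) ej S_carrier[OF s(1)] by (simp add: m_assoc)
    then show ?thesis
      using s eh ei S_carrier[OF s(1)] left_ideal_mult[OF S_left_ideal] by (simp add: m_assoc)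
  qed
  have wc: "w \<in> ?H \<rightarrow> carrier A" using wh S_carrier by auto
  have "x \<in> S" unfolding w(1) using wh by (intro left_ideal_finsum[OF S_left_ideal]) auto
  moreover have "x \<otimes> e i = x"
  proof -
    have "x \<otimes> e i = (\<Oplus>h \<in> ?H. w h \<otimes> e i)" unfolding w(1) using wc ei by (intro finsum_ldistr) auto
    also have "\<dots> = x" unfolding w(1) using wc wh by (intro finsum_cong') auto
    finally show ?thesis .
  qed
  moreover have "e j \<otimes> x = \<zero>"
  proof -
    have "e j \<otimes> x = (\<Oplus>h \<in> ?H. e j \<otimes> w h)" unfolding w(1) using wc ej by (intro finsum_rdistr) auto
    also have "\<dots> = (\<Oplus>h \<in> ?H. \<zero>)" using wh by (intro finsum_cong') auto
    finally show ?thesis by (simp add: finsum_zero)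
  qed
  ultimately show "x \<in> {x \<in> S. x \<otimes> e i = x \<and> e j \<otimes> x = \<zero>}" by simp
next
  fix x
  assume x: "x \<in> {x \<in> S. x \<otimes> e i = x \<and> e j \<otimes> x = \<zero>}"
  then have xc: "x \<in> carrier A" using S_carrier by blast
  have "x = (\<Oplus>h \<in> {1..t} - {j}. e h \<otimes> x)"
    using sum_e_mult[OF xc] x xc e_carrier by (simp add: finsum_closed Pi_def)
  then show "x \<in> W_space A n t e i j"
    using x unfolding W_space_def S_mult_principal[OF i] by blast
qed

text \<open>
  The submodule is described by a condition on the single component at \<open>j\<close>.  In particular \<open>U\<close> is
  recovered as its intersection with \<open>V\<close>.
\<close>
lemma K_sub_eq:
  assumes U: "subspace K U V"
  shows "K_sub A n t e i j U = {x \<in> S. x \<otimes> e i = x \<and> e j \<otimes> x \<in> U}"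
proof (intro Set.set_eqI iffI)
  have UV: "u \<in> S" "e j \<otimes> u = u" "u \<otimes> e i = u" if "u \<in> U" for u
    using that U V_iff[of u] by (auto simp: subspace_def submodule_def)
  fix x
  {
    assume "x \<in> K_sub A n t e i j U"
    then obtain w u where wu: "x = w \<oplus> u" "w \<in> S" "w \<otimes> e i = w" "e j \<otimes> w = \<zero>" "u \<in> U"
      by (auto simp: K_sub_def set_add_def' W_space_eq)
    then show "x \<in> {x \<in> S. x \<otimes> e i = x \<and> e j \<otimes> x \<in> U}"
      using UV[of u] S_carrier ei ej left_ideal_add[OF S_left_ideal] by (simp add: l_distr r_distr)
  next
    assume x: "x \<in> {x \<in> S. x \<otimes> e i = x \<and> e j \<otimes> x \<in> U}"
    then have xc: "x \<in> carrier A" using S_carrier by blast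
    have "x \<ominus> e j \<otimes> x \<in> W_space A n t e i j"
      unfolding W_space_eq
      using x xc ei ej left_ideal_minus[OF S_left_ideal] left_ideal_mult[OF S_left_ideal]
      by (auto simp: a_minus_def l_distr r_distr l_minus r_minus r_neg m_assoc[symmetric])
        (simp add: m_assoc)
    moreover have "x = (x \<ominus> e j \<otimes> x) \<oplus> e j \<otimes> x"
      using xc ej by (simp add: a_minus_def a_assoc l_neg)
    ultimately show "x \<in> K_sub A n t e i j U"
      using x unfolding K_sub_def set_add_def' by blast
  }
qed

text \<open>
  The corner at \<open>e\<^sub>j\<close> acts on \<open>V\<close> through scalars, because its radical part kills \<open>J\<^sup>n\<^sup>-\<^sup>1\<close>.
\<close>
lemma corner_smult_closed:
  assumes U: "subspace K U V" and a: "a \<in> carrier A" and u: "u \<in> U"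
  shows "e j \<otimes> a \<otimes> u \<in> U"
proof -
  have sub: "U \<subseteq> carrier V" and sm: "\<And>c u. \<lbrakk>c \<in> carrier K; u \<in> U\<rbrakk> \<Longrightarrow> c \<odot> u \<in> U"
    using U by (auto simp: subspace_def submodule_def V_space_def)
  have u': "u \<in> S" "e j \<otimes> u = u" using V_iff[of u] u sub by auto
  note uc = S_carrier[OF u'(1)]
  obtain c r where c: "c \<in> carrier K" "r \<in> J" "e j \<otimes> a \<otimes> e j = c \<odot> e j \<oplus> r"
    using corner_decomposition[OF j, of "e j \<otimes> a \<otimes> e j"] a ej
    by (auto simp: m_assoc) (metis m_assoc m_closed)
  have "e j \<otimes> a \<otimes> u = e j \<otimes> a \<otimes> e j \<otimes> u" using u'(2) uc a ej by (simp add: m_assoc)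
  also have "\<dots> = c \<odot> u"
    unfolding c(3) using c u' uc ej J_S_zero[of r u] left_ideal_carrier[OF J_left_ideal c(2)]
    by (simp add: l_distr smult_mult_left)
  finally show ?thesis using sm c u by simp
qed

text \<open>
  In \<open>e\<^sub>j a x = \<Sum>\<^sub>h e\<^sub>j a e\<^sub>h x\<close> the terms with \<open>h \<noteq> j\<close> vanish, since \<open>e\<^sub>j a e\<^sub>h\<close> lies in the radical and
  \<open>x\<close> in \<open>J\<^sup>n\<^sup>-\<^sup>1\<close>; the term with \<open>h = j\<close> stays in \<open>U\<close>.
\<close>
lemma K_sub_left_ideal:
  assumes U: "subspace K U V"
  shows "left_ideal (K_sub A n t e i j U) A"
  unfolding K_sub_eq[OF U]
proof (rule left_idealI)
  have U0: "\<zero> \<in> U" and Ua: "\<And>u v. \<lbrakk>u \<in> U; v \<in> U\<rbrakk> \<Longrightarrow> u \<oplus> v \<in> U"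
    using U by (auto simp: subspace_def submodule_def V_space_def)
  let ?K = "{x \<in> S. x \<otimes> e i = x \<and> e j \<otimes> x \<in> U}"
  show "?K \<subseteq> carrier A" using S_carrier by blast
  show "\<zero> \<in> ?K" using left_ideal_zero[OF S_left_ideal] U0 ei ej by simp
  show "x \<oplus> y \<in> ?K" if "x \<in> ?K" "y \<in> ?K" for x y
    using that S_carrier left_ideal_add[OF S_left_ideal] Ua ei ej by (simp add: l_distr r_distr)
  show "a \<otimes> x \<in> ?K" if a: "a \<in> carrier A" and "x \<in> ?K" for a x
  proof -
    have x: "x \<in> S" "x \<otimes> e i = x" "e j \<otimes> x \<in> U" using that by auto
    note xc = S_carrier[OF x(1)]
    have "e j \<otimes> a \<otimes> (e h \<otimes> x) = \<zero>" if h: "h \<in> {1..t} - {j}" for h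
    proof -
      have "e j \<otimes> a \<otimes> e h \<in> J" using off_diagonal_in_J[OF j _ _ a, of h] h by auto
      then have "e j \<otimes> a \<otimes> e h \<otimes> x = \<zero>" using J_S_zero x by blast
      then show ?thesis using a xc ej e_carrier[of h] h by (simp add: m_assoc)
    qed
    moreover have "e j \<otimes> a \<otimes> (\<Oplus>h \<in> {1..t} - {j}. e h \<otimes> x)
        = (\<Oplus>h \<in> {1..t} - {j}. e j \<otimes> a \<otimes> (e h \<otimes> x))"
      using a xc ej e_carrier by (intro finsum_rdistr) auto
    ultimately have rest: "e j \<otimes> a \<otimes> (\<Oplus>h \<in> {1..t} - {j}. e h \<otimes> x) = \<zero>"
      by (simp add: finsum_zero cong: finsum_cong)
    have "e j \<otimes> (a \<otimes> x) = e j \<otimes> a \<otimes> (e j \<otimes> x \<oplus> (\<Oplus>h \<in> {1..t} - {j}. e h \<otimes> x))"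
      using sum_e_mult[OF xc] a xc ej by (simp add: m_assoc)
    also have "\<dots> = e j \<otimes> a \<otimes> (e j \<otimes> x)"
      using a xc ej e_carrier rest by (simp add: r_distr finsum_closed Pi_def)
    also have "\<dots> \<in> U" by (rule corner_smult_closed[OF U a x(3)])
    finally show ?thesis
      using x xc a ei left_ideal_mult[OF S_left_ideal a x(1)] by (simp add: m_assoc)
  qed
qed

lemma P_simps:
  "carrier P = {x \<in> carrier A. x \<otimes> e i = x}"
  "zero P = \<zero>" "add P = add A" "a \<odot>\<^bsub>P\<^esub> x = a \<otimes> x"
  using principal_left_idempotent_iff[OF idem[OF i]] by (auto simp: left_ideal_module_def)

lemma P_left_module: "left_module A P"
  by (intro left_ideal_module_left_module principal_left_left_ideal ei)

lemma K_sub_left_submodule: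
  assumes U: "subspace K U V"
  shows "left_module.left_submodule A P (K_sub A n t e i j U)"
proof -
  interpret P: left_module A P by (rule P_left_module)
  note L = K_sub_left_ideal[OF U]
  have "K_sub A n t e i j U \<subseteq> carrier P"
    using S_carrier by (auto simp: P_simps K_sub_eq[OF U])
  moreover have "\<ominus>\<^bsub>P\<^esub> x \<in> K_sub A n t e i j U" if x: "x \<in> K_sub A n t e i j U" for x
  proof -
    have xP: "x \<in> carrier P" using x calculation by blast
    have "\<zero> \<ominus> x \<in> K_sub A n t e i j U"
      by (rule left_ideal_minus[OF L left_ideal_zero[OF L] x])
    moreover have "\<zero> \<ominus> x \<in> carrier P" "(\<zero> \<ominus> x) \<oplus>\<^bsub>P\<^esub> x = \<zero>\<^bsub>P\<^esub>"
      using xP ei by (auto simp: P_simps a_minus_def l_minus l_neg)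
    then have "\<ominus>\<^bsub>P\<^esub> x = \<zero> \<ominus> x" using xP P.M.minus_equality by blast
    ultimately show ?thesis by simp
  qed
  ultimately have "additive_subgroup (K_sub A n t e i j U) P"
    using left_ideal_zero[OF L] left_ideal_add[OF L]
    by (intro additive_subgroupI P.M.add.subgroupI) (auto simp: P_simps a_inv_def)
  then show ?thesis
    using left_ideal_mult[OF L] by (simp add: P.left_submodule_def P_simps)
qed

lemma M_mod_fd_left_module:
  assumes U: "subspace K U V"
  shows "fd_left_module K A (M_mod A n t e i j U)"
proof -
  interpret P: left_module A P by (rule P_left_module)
  let ?N = "K_sub A n t e i j U"
  note N = K_sub_left_submodule[OF U]
  have ePi: "e i \<in> carrier P" using ei by (simp add: P_simps)
  show ?thesis
    unfolding M_mod_def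
  proof (rule cyclic_fd_left_module[OF P.factor_module_left_module[OF N]])
    show "?N +>\<^bsub>P\<^esub> e i \<in> carrier (factor_module P ?N)"
      by (rule P.factor_module_carrierI[OF N ePi])
    fix X assume "X \<in> carrier (factor_module P ?N)"
    then obtain x where x: "x \<in> carrier P" "X = ?N +>\<^bsub>P\<^esub> x"
      by (rule P.factor_module_carrierE[OF N])
    then have "X = x \<odot>\<^bsub>factor_module P ?N\<^esub> (?N +>\<^bsub>P\<^esub> e i)"
      using P.factor_module_smult[OF N _ ePi, of x] by (simp add: P_simps)
    then show "\<exists>a\<in>carrier A. X = a \<odot>\<^bsub>factor_module P ?N\<^esub> (?N +>\<^bsub>P\<^esub> e i)"
      using x by (auto simp: P_simps)
  qed
qed

text \<open>
  A homomorphism out of a quotient of \<open>A e\<^sub>i\<close> is determined by the image of the class of \<open>e\<^sub>i\<close>, and a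
  representative \<open>y\<close> of this image may be replaced by \<open>e\<^sub>i y\<close>.
\<close>
lemma M_mod_hom_is_right_mult:
  assumes U: "subspace K U V" and U': "subspace K U' V"
    and f: "f \<in> module_hom A (M_mod A n t e i j U) (M_mod A n t e i j U')"
  obtains x where "x \<in> carrier A" "e i \<otimes> x = x" "x \<otimes> e i = x"
    "\<And>a. a \<in> carrier P \<Longrightarrow> f (K_sub A n t e i j U +>\<^bsub>P\<^esub> a) = K_sub A n t e i j U' +>\<^bsub>P\<^esub> (a \<otimes> x)"
proof -
  interpret P: left_module A P by (rule P_left_module)
  let ?N = "K_sub A n t e i j U" and ?N' = "K_sub A n t e i j U'"
  note N = K_sub_left_submodule[OF U] and N' = K_sub_left_submodule[OF U']
  have ePi: "e i \<in> carrier P" using ei by (simp add: P_simps)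
  have "f (?N +>\<^bsub>P\<^esub> e i) \<in> carrier (factor_module P ?N')"
    using module_hom_closed[OF f] P.factor_module_carrierI[OF N ePi] by (auto simp: M_mod_def)
  then obtain y where y: "y \<in> carrier P" "f (?N +>\<^bsub>P\<^esub> e i) = ?N' +>\<^bsub>P\<^esub> y"
    by (rule P.factor_module_carrierE[OF N'])
  have yA: "y \<in> carrier A" "y \<otimes> e i = y" using y by (auto simp: P_simps)
  show thesis
  proof (rule that[of "e i \<otimes> y"])
    fix a assume a: "a \<in> carrier P"
    then have aA: "a \<in> carrier A" "a \<otimes> e i = a" by (auto simp: P_simps)
    have "f (?N +>\<^bsub>P\<^esub> a) = f (a \<odot>\<^bsub>factor_module P ?N\<^esub> (?N +>\<^bsub>P\<^esub> e i))"
      using P.factor_module_smult[OF N aA(1) ePi] aA by (simp add: P_simps)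
    also have "\<dots> = a \<odot>\<^bsub>factor_module P ?N'\<^esub> f (?N +>\<^bsub>P\<^esub> e i)"
      using module_hom_smult[OF f aA(1)] P.factor_module_carrierI[OF N ePi] by (simp add: M_mod_def)
    also have "\<dots> = ?N' +>\<^bsub>P\<^esub> (a \<otimes> y)"
      using P.factor_module_smult[OF N' aA(1) y(1)] y(2) by (simp add: P_simps)
    also have "a \<otimes> y = a \<otimes> (e i \<otimes> y)" using aA yA ei by (simp flip: m_assoc)
    finally show "f (?N +>\<^bsub>P\<^esub> a) = ?N' +>\<^bsub>P\<^esub> (a \<otimes> (e i \<otimes> y))" .
  qed (use yA ei in \<open>simp_all add: m_assoc, simp_all flip: m_assoc\<close>)
qed

text \<open>
  The isomorphism is right multiplication by some \<open>x = c e\<^sub>i + r\<close> with \<open>r\<close> in the radical.  Elements of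
  \<open>J\<^sup>n\<^sup>-\<^sup>1\<close> are killed by \<open>r\<close> from the right, so \<open>x\<close> acts on \<open>V\<close> as the scalar \<open>c\<close>, and \<open>U\<close> is mapped to
  \<open>cU\<close>, which must lie in \<open>U'\<close>.  If \<open>c\<close> were zero, all of \<open>V\<close> would have to lie in \<open>U'\<close> by surjectivity.
\<close>
lemma subset_of_M_mod_isomorphic:
  assumes U: "subspace K U V" and U': "subspace K U' V" and proper: "U' \<noteq> carrier V"
    and iso: "modules_isomorphic A (M_mod A n t e i j U) (M_mod A n t e i j U')"
  shows "U \<subseteq> U'"
proof -
  interpret P: left_module A P by (rule P_left_module)
  let ?N = "K_sub A n t e i j U" and ?N' = "K_sub A n t e i j U'"
  note N = K_sub_left_submodule[OF U] and N' = K_sub_left_submodule[OF U']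
  note L' = K_sub_left_ideal[OF U']
  have ePi: "e i \<in> carrier P" using ei by (simp add: P_simps)
  have UV: "U \<subseteq> carrier V" and UV': "U' \<subseteq> carrier V"
    and sm': "\<And>c u. \<lbrakk>c \<in> carrier K; u \<in> U'\<rbrakk> \<Longrightarrow> c \<odot> u \<in> U'"
    using U U' by (auto simp: subspace_def submodule_def V_space_def)
  obtain f where f: "f \<in> module_hom A (M_mod A n t e i j U) (M_mod A n t e i j U')"
    and surj: "f ` carrier (factor_module P ?N) = carrier (factor_module P ?N')"
    using iso by (auto simp: modules_isomorphic_def bij_betw_def M_mod_def)
  obtain x where x: "x \<in> carrier A" "e i \<otimes> x = x" "x \<otimes> e i = x"
    and fx: "\<And>a. a \<in> carrier P \<Longrightarrow> f (?N +>\<^bsub>P\<^esub> a) = ?N' +>\<^bsub>P\<^esub> (a \<otimes> x)"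
    using M_mod_hom_is_right_mult[OF U U' f] by blast
  obtain c r where c: "c \<in> carrier K" "r \<in> J" "e i \<otimes> r = r" "r \<otimes> e i = r" "x = c \<odot> e i \<oplus> r"
    using corner_decomposition[OF i x] .
  note rc = left_ideal_carrier[OF J_left_ideal c(2)]
  have c0: "c \<noteq> \<zero>\<^bsub>K\<^esub>"
  proof
    assume "c = \<zero>\<^bsub>K\<^esub>"
    then have xr: "x = r" using c(5) ei rc by simp
    have "?N' +>\<^bsub>P\<^esub> e i \<in> f ` carrier (factor_module P ?N)"
      using surj P.factor_module_carrierI[OF N' ePi] by simp
    then obtain X where "X \<in> carrier (factor_module P ?N)" "f X = ?N' +>\<^bsub>P\<^esub> e i" by auto
    then obtain a where a: "a \<in> carrier P" "f (?N +>\<^bsub>P\<^esub> a) = ?N' +>\<^bsub>P\<^esub> e i"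
      using P.factor_module_carrierE[OF N] by metis
    \<comment> \<open>Multiplying \<open>e\<^sub>i - a x \<in> K\<^sub>U\<^sub>'\<close> on the left by \<open>v\<close> kills \<open>a x\<close>.\<close>
    have aA: "a \<in> carrier A" using a by (simp add: P_simps)
    have axP: "a \<otimes> x \<in> carrier P" using aA x ei by (simp add: P_simps m_assoc)
    have "?N' +>\<^bsub>P\<^esub> e i = ?N' +>\<^bsub>P\<^esub> (a \<otimes> x)" using fx[OF a(1)] a(2) by simp
    then have "e i \<in> ?N' +>\<^bsub>P\<^esub> (a \<otimes> x)"
      using abelian_subgroup.a_rcos_self[OF abelian_subgroupI3 ePi, of ?N'] N'
      by (simp add: P.left_submodule_def P.M.abelian_group_axioms)
    then obtain m where m: "m \<in> ?N'" "e i = m \<oplus> a \<otimes> x"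
      by (auto simp: a_r_coset_def' P_simps)
    have "v \<in> U'" if v: "v \<in> carrier V" for v
    proof -
      have v': "v \<in> S" "e j \<otimes> v = v" "v \<otimes> e i = v" using v V_iff by auto
      note vc = S_carrier[OF v'(1)]
      have "v \<otimes> a \<otimes> x = \<zero>" using S_J_zero[OF S_mult_right[OF aA v'(1)] c(2)] xr by simp
      then have "v \<otimes> e i = v \<otimes> m"
        unfolding m(2) using vc aA x(1) left_ideal_carrier[OF L' m(1)]
        by (simp add: r_distr m_assoc)
      then have "v \<in> ?N'" using v'(3) left_ideal_mult[OF L' vc m(1)] by simp
      then show ?thesis using v'(2) by (simp add: K_sub_eq[OF U'])
    qed
    then show False using proper UV' by blast
  qed
  then have "c \<in> Units K" using c(1) by (simp add: field_Units)
  then obtain d where d: "d \<in> carrier K" "d \<otimes>\<^bsub>K\<^esub> c = \<one>\<^bsub>K\<^esub>" by (auto simp: Units_def)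
  show ?thesis
  proof
    fix u assume u: "u \<in> U"
    then have u': "u \<in> S" "e j \<otimes> u = u" "u \<otimes> e i = u" using UV V_iff by auto
    note uc = S_carrier[OF u'(1)]
    have uN: "u \<in> ?N" using u u' by (simp add: K_sub_eq[OF U])
    have uP: "u \<in> carrier P" using u' uc by (simp add: P_simps)
    have 0: "\<zero> \<in> ?N" "\<zero> \<in> carrier P"
      using left_ideal_zero[OF K_sub_left_ideal[OF U]] ei by (auto simp: P_simps)
    have "?N +>\<^bsub>P\<^esub> u = ?N +>\<^bsub>P\<^esub> \<zero>"
      using P.factor_module_zero_iff[OF N] uP uN 0 by metis
    then have "?N' +>\<^bsub>P\<^esub> (u \<otimes> x) = ?N' +>\<^bsub>P\<^esub> (\<zero> \<otimes> x)"
      using fx uP 0 by metis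
    then have "?N' +>\<^bsub>P\<^esub> (u \<otimes> x) = ?N' +>\<^bsub>P\<^esub> \<zero>" using x by simp
    moreover have "u \<otimes> x = c \<odot> u"
      using c u' uc rc ei S_J_zero[OF u'(1) c(2)] by (simp add: r_distr smult_mult_right)
    moreover have "c \<odot> u \<in> carrier P"
      using c(1) u'(3) uc ei by (simp add: P_simps smult_mult_left)
    ultimately have "c \<odot> u \<in> ?N'"
      using P.factor_module_zero_iff[OF N'] left_ideal_zero[OF L'] 0 by metis
    then have "c \<odot> u \<in> U'"
      using c(1) u' uc ej by (simp add: K_sub_eq[OF U'] smult_mult_right)
    then have "d \<odot> (c \<odot> u) \<in> U'" by (rule sm'[OF d(1)])
    then show "u \<in> U'" using c(1) d uc by (simp flip: smult_assoc1)
  qed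
qed

end

end

section \<open>The terminal fibre is a Grassmannian\<close>

theorem theorem6p4:
  fixes K :: "('k, 'y) ring_scheme" and \<Lambda> :: "('k, 'a, 'z) module_scheme"
    and n t i j s :: nat and e :: "nat \<Rightarrow> 'a"
  assumes "fd_algebra K \<Lambda>"
    and "n \<ge> 1"
    and "ideal_power \<Lambda> (jacobson_radical \<Lambda>) n = {\<zero>\<^bsub>\<Lambda>\<^esub>}"
    and "complete_primitive_idempotents \<Lambda> t e"
    and "basic_algebra \<Lambda> t e"
    and "split_algebra K \<Lambda> t e"
    and "i \<in> {1..t}" and "j \<in> {1..t}"
    and "carrier (V_space \<Lambda> n e i j) \<noteq> {\<zero>\<^bsub>\<Lambda>\<^esub>}"
    and "1 \<le> s" and "s \<le> vectorspace.dim K (V_space \<Lambda> n e i j)"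
  shows "bij_betw
           (\<lambda>U. fd_module_iso_rel K \<Lambda> `` {M_mod \<Lambda> n t e i j U})
           (grassmannian K (V_space \<Lambda> n e i j) (vectorspace.dim K (V_space \<Lambda> n e i j) - s))
           (terminal_fibre K \<Lambda> n t e i j s)"
proof -
  interpret nilpotent_basic_split_algebra K \<Lambda> n t e
    using assms by (simp add: nilpotent_basic_split_algebra_def nilpotent_basic_split_algebra_axioms_def)
  note ij = assms(7,8)
  let ?V = "V_space \<Lambda> n e i j" and ?M = "M_mod \<Lambda> n t e i j" and ?R = "fd_module_iso_rel K \<Lambda>"
  let ?G = "grassmannian K ?V (vectorspace.dim K ?V - s)"
  have sub: "subspace K U ?V" if "U \<in> ?G" for U
    using that by (simp add: grassmannian_def)
  have proper: "U \<noteq> carrier ?V" if "U \<in> ?G" for U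
  proof
    assume "U = carrier ?V"
    then have "vectorspace.dim K ?V = vectorspace.dim K ?V - s"
      using that by (simp add: grassmannian_def)
    then show False using assms(10,11) by linarith
  qed
  \<comment> \<open>The class of a record that is not a finite-dimensional module would be empty.\<close>
  have refl: "(?M U, ?M U) \<in> ?R" if "U \<in> ?G" for U
  proof -
    have "modules_isomorphic \<Lambda> (?M U) (?M U)"
      unfolding modules_isomorphic_def
      by (intro bexI[of _ "\<lambda>x. x"]) (auto simp: module_hom_def bij_betw_def)
    then show ?thesis
      using M_mod_fd_left_module[OF ij sub[OF that]] by (simp add: fd_module_iso_rel_def)
  qed
  have "inj_on (\<lambda>U. ?R `` {?M U}) ?G"
  proof (rule inj_onI)
    fix U U' assume U: "U \<in> ?G" "U' \<in> ?G" and eq: "?R `` {?M U} = ?R `` {?M U'}"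
    have "(?M U, ?M U') \<in> ?R" "(?M U', ?M U) \<in> ?R"
      using eq refl[OF U(1)] refl[OF U(2)] by auto
    then show "U = U'"
      using subset_of_M_mod_isomorphic[OF ij] U sub proper
      by (auto simp: fd_module_iso_rel_def)
  qed
  moreover have "terminal_fibre K \<Lambda> n t e i j s = (\<lambda>U. ?R `` {?M U}) ` ?G"
    by (auto simp: terminal_fibre_def quotient_def)
  ultimately show ?thesis by (simp add: bij_betw_def)
qed

end
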